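(* Assume $\rho(\partial_0 f)<1$, and let $\tilde p$, $\tilde R$, $D_a(0)$ and the sets $\tilde N_p$ be as defined in the context. For any $x\in D_a(0)$ there exists $p^x\geq\tilde p$ such that $x\in\tilde N_{p^x}$.
   Context: Let $\Omega\subset\mathbb{R}^n$ be a domain (open connected set) with $0\in\Omega$, and let $f:\Omega\to\Omega$ be an $\mathbb{R}$-analytic function with $f(0)=0$. Write $f^k$ for the $k$-th iterate of $f$ ($f^0=\mathrm{id}$), $\|\cdot\|$ for the Euclidean norm on $\mathbb{R}^n$ and for the induced operator norm on matrices, $A=\partial_0 f$ for the Jacobian matrix of $f$ at $0$, $\rho(A)$ for its spectral radius, and $B(r)=\{x\in\mathbb{R}^n:\|x\|<r\}$ for $r>0$. The domain of attraction of $0$ is $D_a(0)=\{x\in\Omega: f^k(x)\to 0 \text{ as } k\to\infty\}$. Standing assumption: $\rho(A)<1$. Let $\tilde p\geq 1$ be the smallest positive integer such that $\|A^p\|<1$ for any $p\geq\tilde p$. Let $\tilde R>0$ be the largest number such that $B(\tilde R)\subset\Omega$ and $\|f^p(x)\|<\|x\|$ for all $p\in\{\tilde p,\tilde p+1,\dots,2\tilde p-1\}$ and $x\in B(\tilde R)\setminus\{0\}$ (some positive radius with this property exists); if every $r>0$ has this property, then $\tilde R=+\infty$ and $B(\tilde R)=\Omega=\mathbb{R}^n$. For an integer $p\ge 0$ and $x\in\Omega$ put $V_p(x)=\sum_{k=0}^{p}\|f^k(x)\|^2$. For an integer $p\geq\tilde p$ put $\tilde N_p=\{x\in\Omega: V_p(x)<(p+1)\tilde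 R^2\}$, with $\tilde N_p=\Omega$ if $\tilde R=+\infty$. *)

theory Defs
  imports "HOL-Analysis.Analysis"
begin

text \<open>
  Real analyticity: around every point of \<open>S\<close> the function is the sum of a power series in the
  \<open>n\<close> coordinates. Multi-indices are functions \<open>\<alpha> :: 'n \<Rightarrow> nat\<close>; \<open>has_sum\<close> is unconditional
  summation, which for these series is the same as absolute convergence.
\<close>

definition real_analytic_on :: "(real ^ 'n \<Rightarrow> real ^ 'm) \<Rightarrow> (real ^ 'n) set \<Rightarrow> bool"
    (infix "real'_analytic'_on" 50) where
  "f real_analytic_on S \<longleftrightarrow>
     (\<forall>a\<in>S. \<exists>r>0. \<exists>c :: ('n \<Rightarrow> nat) \<Rightarrow> real ^ 'm.
        \<forall>x\<in>ball a r. ((\<lambda>\<alpha>. (\<Prod>i\<in>UNIV. (x $ i - a $ i) ^ \<alpha> i) *\<^sub>R c \<alpha>) has_sum f x) UNIV)"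

text \<open>
  Powers for the matrix product \<open>**\<close>; on square matrices the overloaded \<open>^\<close> is the
  entrywise power.
\<close>

definition matrix_power :: "real ^ 'n ^ 'n \<Rightarrow> nat \<Rightarrow> real ^ 'n ^ 'n" where
  "matrix_power A p = (((**) A) ^^ p) (mat 1)"

definition matrix_norm :: "real ^ 'n ^ 'm \<Rightarrow> real" where
  "matrix_norm A = onorm ((*v) A)"

text \<open>The spectrum consists of all complex eigenvalues, hence the passage to a complex matrix.\<close>

definition matrix_spectrum :: "real ^ 'n ^ 'n \<Rightarrow> complex set" where
  "matrix_spectrum A = {l. \<exists>v. v \<noteq> 0 \<and> map_matrix complex_of_real A *v v = l *s v}"

definition matrix_spectral_radius :: "real ^ 'n ^ 'n \<Rightarrow> real" where
  "matrix_spectral_radius A = Max (cmod ` matrix_spectrum A)"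

definition attraction_domain :: "(real ^ 'n \<Rightarrow> real ^ 'n) \<Rightarrow> (real ^ 'n) set \<Rightarrow> (real ^ 'n) set" where
  "attraction_domain f \<Omega> = {x \<in> \<Omega>. (\<lambda>k. (f ^^ k) x) \<longlonglongrightarrow> 0}"

definition p_tilde :: "(real ^ 'n \<Rightarrow> real ^ 'n) \<Rightarrow> nat" where
  "p_tilde f =
     (LEAST q. 1 \<le> q \<and> (\<forall>p\<ge>q. matrix_norm (matrix_power (jacobian f (at 0)) p) < 1))"

definition contraction_radius ::
    "(real ^ 'n \<Rightarrow> real ^ 'n) \<Rightarrow> (real ^ 'n) set \<Rightarrow> real \<Rightarrow> bool" where
  "contraction_radius f \<Omega> r \<longleftrightarrow> 0 < r \<and> ball 0 r \<subseteq> \<Omega> \<and>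
     (\<forall>p\<in>{p_tilde f..2 * p_tilde f - 1}. \<forall>x\<in>ball 0 r - {0}. norm ((f ^^ p) x) < norm x)"

definition R_tilde :: "(real ^ 'n \<Rightarrow> real ^ 'n) \<Rightarrow> (real ^ 'n) set \<Rightarrow> ereal" where
  "R_tilde f \<Omega> =
     (if \<forall>r>0. contraction_radius f \<Omega> r then \<infinity>
      else ereal (GREATEST r. contraction_radius f \<Omega> r))"

definition V_sum :: "(real ^ 'n \<Rightarrow> real ^ 'n) \<Rightarrow> nat \<Rightarrow> real ^ 'n \<Rightarrow> real" where
  "V_sum f p x = (\<Sum>k=0..p. (norm ((f ^^ k) x))\<^sup>2)"

definition N_tilde ::
    "(real ^ 'n \<Rightarrow> real ^ 'n) \<Rightarrow> (real ^ 'n) set \<Rightarrow> nat \<Rightarrow> (real ^ 'n) set" where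
  "N_tilde f \<Omega> p =
     (if R_tilde f \<Omega> = \<infinity> then \<Omega>
      else {x \<in> \<Omega>. V_sum f p x < (real p + 1) * (real_of_ereal (R_tilde f \<Omega>))\<^sup>2})"

end

theory Submission
  imports Defs "HOL-Computational_Algebra.Fundamental_Theorem_Algebra"
begin

text \<open>
  The claim is a Cesaro argument: along an orbit that converges to \<open>0\<close> the average
  \<open>V_sum f p x / (p + 1)\<close> of the squared norms tends to \<open>0\<close>, so it drops below every fixed
  positive number for some arbitrarily large \<open>p\<close> (\<open>sum_less_if_tendsto_0\<close>). What has to be shown
  is that the threshold, the square of \<open>R_tilde f \<Omega>\<close>, is positive whenever it is finite.

  For this a radius of contraction must exist. A power series may be differentiated at its centre
  (\<open>real_analytic_imp_differentiable\<close>), so by the chain rule \<open>f ^^ p\<close> has the \<open>p\<close>-th power of the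
  Jacobian \<open>A\<close> as its derivative at \<open>0\<close>. If that power has operator norm below \<open>1\<close>, then \<open>f ^^ p\<close>
  shrinks norms near \<open>0\<close>; only finitely many \<open>p\<close> matter, so one ball serves them all
  (\<open>contraction_radius_exists\<close>). The set of these radii is closed under decreasing to a
  positive number and under bounded suprema, so it is either all of the positive reals or has a
  greatest element (\<open>contraction_radius_Greatest\<close>).

  The remaining ingredient is that a spectral radius below \<open>1\<close> makes the powers of \<open>A\<close> tend to \<open>0\<close>.
  Some nonzero polynomial annihilates \<open>A\<close>, because the powers of \<open>A\<close> lie in a finite-dimensional space, and induction on
  its degree, removing one root at a time, gives the decay of every orbit
  (\<open>orbit_tendsto_0_if_annihilated\<close>). The same polynomial has all eigenvalues among its roots, so
  the spectrum is finite and the maximum that defines the spectral radius bounds each eigenvalue.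
\<close>

section \<open>Annihilating polynomials\<close>

text \<open>
  The vector \<open>p(A) v\<close>, computed by Horner's scheme. It is defined on vectors, without
  forming the matrix \<open>p(A)\<close>, because the overloaded product and power of matrices are entrywise.
\<close>

definition poly_apply :: "complex ^ 'n ^ 'n \<Rightarrow> complex poly \<Rightarrow> complex ^ 'n \<Rightarrow> complex ^ 'n" where
  "poly_apply A p v = fold_coeffs (\<lambda>a w. a *s v + A *v w) p 0"

lemma poly_apply_0 [simp]: "poly_apply A 0 v = 0"
  by (simp add: poly_apply_def)

lemma poly_apply_pCons [simp]: "poly_apply A (pCons a p) v = a *s v + A *v poly_apply A p v"
  by (cases "a = 0 \<and> p = 0") (auto simp: poly_apply_def)

lemma poly_apply_add: "poly_apply A (p + q) v = poly_apply A p v + poly_apply A q v"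
  by (induction p q rule: poly_induct2)
    (simp_all add: matrix_vector_right_distrib vector_sadd_rdistrib)

lemma poly_apply_smult: "poly_apply A (smult c p) v = c *s poly_apply A p v"
  by (induction p)
    (simp_all add: vector_add_ldistrib vector_smult_assoc vector_scalar_commute)

lemma poly_apply_sum: "poly_apply A (sum g I) v = (\<Sum>i\<in>I. poly_apply A (g i) v)"
  by (induction I rule: infinite_finite_induct) (simp_all add: poly_apply_add)

text \<open>
  Since polynomials commute, a factor of \<open>p\<close> can be applied either last or first; the decay of
  orbits uses both orders.
\<close>

lemma poly_apply_mult: "poly_apply A (p * q) v = poly_apply A p (poly_apply A q v)"
  by (induction p) (simp_all add: poly_apply_add poly_apply_smult)

lemma poly_apply_linear_factor: "poly_apply A [:- l, 1:] v = A *v v - l *s v"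
  by (simp add: vec_eq_iff)

lemma poly_apply_eigenvector:
  assumes "A *v v = l *s v"
  shows "poly_apply A p v = poly p l *s v"
  by (induction p)
    (simp_all add: vector_sadd_rdistrib vector_scalar_commute assms vector_smult_assoc mult.commute)

lemma matrix_power_mult_vector: "matrix_power A k *v v = (((*v) A) ^^ k) v"
  by (induction k) (simp_all add: matrix_power_def matrix_vector_mul_assoc[symmetric])

text \<open>
  The constant \<^const>\<open>matrix_power\<close> is confined to real matrices; the complexified Jacobian needs
  its own copy of the same fact.
\<close>

lemma complex_matrix_power_mult_vector:
  fixes A :: "complex ^ 'n ^ 'n"
  shows "(((**) A) ^^ k) (mat 1) *v v = (((*v) A) ^^ k) v"
  by (induction k) (simp_all add: matrix_vector_mul_assoc[symmetric])

lemma poly_apply_monom: "poly_apply A (monom c k) v = c *s (((*v) A) ^^ k) v"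
  by (induction k) (simp_all add: monom_0 monom_Suc vector_scalar_commute)

text \<open>
  Among \<open>DIM('a) + 1\<close> vectors there is a linear relation. The index form, as opposed to linear
  dependence of a set, also covers a sequence that repeats a value: then the difference of two equal
  terms is the relation.
\<close>

lemma linear_relation_in_sequence:
  fixes B :: "nat \<Rightarrow> 'a::euclidean_space"
  obtains N :: nat and u :: "nat \<Rightarrow> real"
  where "\<exists>k\<le>N. u k \<noteq> 0" "(\<Sum>k\<le>N. u k *\<^sub>R B k) = 0"
proof (cases "inj_on B {..DIM('a)}")
  case True
  then have "card (B ` {..DIM('a)}) > DIM('a)"
    by (simp add: card_image)
  then have "dependent (B ` {..DIM('a)})"
    using independent_bound by fastforce
  then obtain w where w: "\<exists>x\<in>B ` {..DIM('a)}. w x \<noteq> 0" "(\<Sum>x\<in>B ` {..DIM('a)}. w x *\<^sub>R x) = 0"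
    by (subst (asm) real_vector.dependent_finite) auto
  show ?thesis
    by (rule that[of "DIM('a)" "w \<circ> B"]) (use w True in \<open>auto simp: sum.reindex\<close>)
next
  case False
  then obtain i j where ij: "i \<le> DIM('a)" "j \<le> DIM('a)" "i \<noteq> j" "B i = B j"
    unfolding inj_on_def by auto
  let ?u = "\<lambda>k. if k = i then 1 else if k = j then - 1 else (0::real)"
  have "(\<Sum>k\<le>DIM('a). ?u k *\<^sub>R B k)
      = (\<Sum>k\<le>DIM('a). (if k = i then B i else 0) - (if k = j then B j else 0))"
    using ij by (intro sum.cong) auto
  also have "\<dots> = 0"
    using ij by (simp add: sum_subtractf)
  finally show ?thesis
    using ij(1) by (intro that[of "DIM('a)" ?u] exI[of _ i]) auto
qed

lemma scaleR_matrix_vector_complex: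
  fixes M :: "complex ^ 'n ^ 'm"
  shows "(c *\<^sub>R M) *v v = complex_of_real c *s (M *v v)"
  by (simp add: vec_eq_iff matrix_vector_mult_def sum_distrib_left scaleR_conv_of_real[where 'a = complex]
      mult.assoc)

lemma matrix_sum_mult_vector:
  fixes M :: "'i \<Rightarrow> 'a::comm_semiring_1 ^ 'n ^ 'm"
  shows "(\<Sum>i\<in>I. M i) *v v = (\<Sum>i\<in>I. M i *v v)"
  by (induction I rule: infinite_finite_induct) (simp_all add: matrix_vector_mult_add_rdistrib)

text \<open>
  The powers of \<open>A\<close> are a sequence in a finite-dimensional real vector space, so they satisfy a
  linear relation, whose coefficients are those of the polynomial.
\<close>

lemma annihilating_polynomial:
  fixes A :: "complex ^ 'n ^ 'n"
  obtains P where "P \<noteq> 0" "\<And>v. poly_apply A P v = 0"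
proof -
  obtain N u where Nu: "\<exists>k\<le>N. u k \<noteq> 0" "(\<Sum>k\<le>N. u k *\<^sub>R (((**) A) ^^ k) (mat 1)) = 0"
    using linear_relation_in_sequence[of "\<lambda>k. (((**) A) ^^ k) (mat 1)"] by blast
  let ?P = "\<Sum>k\<le>N. monom (complex_of_real (u k)) k"
  obtain j where j: "j \<le> N" "u j \<noteq> 0"
    using Nu(1) by blast
  have "coeff ?P j = complex_of_real (u j)"
    using j by (simp add: coeff_sum)
  then have "?P \<noteq> 0"
    using j(2) by (metis coeff_0 of_real_eq_0_iff)
  moreover have "poly_apply A ?P v = (\<Sum>k\<le>N. u k *\<^sub>R (((**) A) ^^ k) (mat 1)) *v v" for v
    by (simp add: poly_apply_sum poly_apply_monom matrix_sum_mult_vector scaleR_matrix_vector_complex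
        complex_matrix_power_mult_vector)
  ultimately show ?thesis
    using Nu(2) that by simp
qed

section \<open>Spectral radius and decay of matrix powers\<close>

text \<open>
  From an index on where \<open>b\<close> stays below \<open>(e / 2) * (1 - q)\<close>, the recursion maps \<open>e / 2\<close> to at most
  \<open>e / 2\<close>, and the initial value only enters with the decaying factor \<open>q ^ m\<close>.
\<close>

lemma perturbed_contraction_tendsto_0:
  fixes a b :: "nat \<Rightarrow> real"
  assumes step: "\<And>k. a (Suc k) \<le> q * a k + b k" and a: "\<And>k. 0 \<le> a k"
    and q: "0 \<le> q" "q < 1" and b: "b \<longlonglongrightarrow> 0"
  shows "a \<longlonglongrightarrow> 0"
proof (rule LIMSEQ_I)
  fix e :: real
  assume e: "0 < e"
  have "0 < (e / 2) * (1 - q)"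
    using e q by simp
  then obtain K where K: "\<And>k. k \<ge> K \<Longrightarrow> b k < (e / 2) * (1 - q)"
    using order_tendstoD(2)[OF b] unfolding eventually_sequentially by blast
  have bound: "a (K + m) \<le> q ^ m * a K + e / 2" for m
  proof (induction m)
    case 0
    then show ?case using e by simp
  next
    case (Suc m)
    have "a (K + Suc m) \<le> q * a (K + m) + b (K + m)"
      using step[of "K + m"] by simp
    also have "\<dots> \<le> q * (q ^ m * a K + e / 2) + (e / 2) * (1 - q)"
      using mult_left_mono[OF Suc.IH q(1)] K[of "K + m"] by simp
    also have "\<dots> = q ^ Suc m * a K + e / 2"
      by (simp add: field_simps)
    finally show ?case .
  qed
  have "(\<lambda>m. q ^ m * a K) \<longlonglongrightarrow> 0"
    using q by (intro tendsto_mult_left_zero LIMSEQ_power_zero) simp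
  then obtain M where M: "\<And>m. m \<ge> M \<Longrightarrow> q ^ m * a K < e / 2"
    using order_tendstoD(2)[of _ 0 sequentially "e / 2"] e unfolding eventually_sequentially
    by (metis half_gt_zero)
  have "norm (a k - 0) < e" if k: "k \<ge> K + M" for k
  proof -
    have "a k < e"
      using bound[of "k - K"] M[of "k - K"] k by fastforce
    then show ?thesis
      using a[of k] by simp
  qed
  then show "\<exists>no. \<forall>n\<ge>no. norm (a n - 0) < e"
    by blast
qed

lemma norm_vector_smult_complex:
  fixes v :: "complex ^ 'n"
  shows "norm (c *s v) = cmod c * norm v"
  by (simp add: norm_vec_def norm_mult L2_set_right_distrib)

text \<open>
  Split off a root \<open>l\<close> of \<open>P\<close>, say \<open>P = (X - l) Q\<close>. If \<open>l\<close> is not an eigenvalue, \<open>A - l\<close> is injective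
  and already \<open>Q\<close> annihilates \<open>v\<close>. If it is one, then \<open>\<bar>l\<bar> < 1\<close>, and \<open>Q\<close> annihilates
  \<open>w = A v - l v\<close>, whose orbit tends to \<open>0\<close> by induction; the orbit of \<open>v\<close> obeys
  \<open>A\<^sup>k\<^sup>+\<^sup>1 v = l A\<^sup>k v + A\<^sup>k w\<close>, a contraction with vanishing perturbation.
\<close>

lemma orbit_tendsto_0_if_annihilated:
  fixes A :: "complex ^ 'n ^ 'n"
  assumes eig: "\<And>l v. v \<noteq> 0 \<Longrightarrow> A *v v = l *s v \<Longrightarrow> cmod l < 1"
    and "P \<noteq> 0" "poly_apply A P v = 0"
  shows "(\<lambda>k. (((*v) A) ^^ k) v) \<longlonglongrightarrow> 0"
  using assms(2,3)
proof (induction "degree P" arbitrary: P v)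
  case 0
  then obtain c where "P = [:c:]" "c \<noteq> 0"
    by (metis degree_eq_zeroE pCons_0_0)
  with 0 have "v = 0"
    by simp
  moreover have "(((*v) A) ^^ k) 0 = 0" for k
    by (induction k) simp_all
  ultimately show ?case
    by simp
next
  case (Suc n)
  have "\<not> constant (poly P)"
    using Suc.hyps(2) by (simp add: constant_degree)
  then obtain l where "poly P l = 0"
    using fundamental_theorem_of_algebra by blast
  then obtain Q where P: "P = [:- l, 1:] * Q"
    unfolding poly_eq_0_iff_dvd dvd_def by blast
  with \<open>P \<noteq> 0\<close> have Q: "Q \<noteq> 0"
    by auto
  have "degree P = Suc (degree Q)"
    unfolding P using Q by (subst degree_mult_eq) auto
  with Suc.hyps(2) have deg: "n = degree Q"
    by simp
  show ?case
  proof (cases "\<exists>w. w \<noteq> 0 \<and> A *v w = l *s w")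
    case False
    have "A *v poly_apply A Q v = l *s poly_apply A Q v"
      using Suc.prems(2) unfolding P poly_apply_mult poly_apply_linear_factor by simp
    with False have "poly_apply A Q v = 0"
      by blast
    then show ?thesis
      using Suc.hyps(1)[OF deg Q] by blast
  next
    case True
    then have l: "cmod l < 1"
      using eig by blast
    define w where "w = A *v v - l *s v"
    have "poly_apply A Q w = 0"
      using Suc.prems(2) unfolding P mult.commute[of _ Q] poly_apply_mult poly_apply_linear_factor w_def .
    then have w: "(\<lambda>k. (((*v) A) ^^ k) w) \<longlonglongrightarrow> 0"
      using Suc.hyps(1)[OF deg Q] by blast
    have rec: "(((*v) A) ^^ Suc k) v = l *s ((((*v) A) ^^ k) v) + (((*v) A) ^^ k) w" for k
      by (induction k)
        (simp_all add: w_def matrix_vector_right_distrib vector_scalar_commute)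
    have "(\<lambda>k. norm ((((*v) A) ^^ k) v)) \<longlonglongrightarrow> 0"
    proof (rule perturbed_contraction_tendsto_0)
      show "norm ((((*v) A) ^^ Suc k) v)
          \<le> cmod l * norm ((((*v) A) ^^ k) v) + norm ((((*v) A) ^^ k) w)" for k
        unfolding rec norm_vector_smult_complex[symmetric] by (rule norm_triangle_ineq)
      show "(\<lambda>k. norm ((((*v) A) ^^ k) w)) \<longlonglongrightarrow> 0"
        using w by (rule tendsto_norm_zero)
    qed (use l in auto)
    then show ?thesis
      by (rule tendsto_norm_zero_cancel)
  qed
qed

text \<open>
  An annihilating polynomial vanishes at every eigenvalue. Finiteness is what makes the \<open>Max\<close> in the
  spectral radius an upper bound for the moduli of the eigenvalues.
\<close>

lemma finite_matrix_spectrum: "finite (matrix_spectrum A)"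
proof -
  obtain P where P: "P \<noteq> 0" "\<And>v. poly_apply (map_matrix complex_of_real A) P v = 0"
    using annihilating_polynomial by blast
  have "matrix_spectrum A \<subseteq> {l. poly P l = 0}"
  proof
    fix l assume "l \<in> matrix_spectrum A"
    then obtain v where "v \<noteq> 0" "map_matrix complex_of_real A *v v = l *s v"
      unfolding matrix_spectrum_def by blast
    then show "l \<in> {l. poly P l = 0}"
      using P(2)[of v] by (simp add: poly_apply_eigenvector)
  qed
  then show ?thesis
    using poly_roots_finite[OF P(1)] finite_subset by blast
qed

lemma map_matrix_power_of_real:
  fixes A :: "real ^ 'n ^ 'n"
  shows "(((*v) (map_matrix complex_of_real A)) ^^ k) (\<chi> i. complex_of_real (v $ i))
    = (\<chi> i. complex_of_real (((((*v) A) ^^ k) v) $ i))"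
proof (induction k)
  case (Suc k)
  have "map_matrix complex_of_real A *v (\<chi> i. complex_of_real (w $ i))
      = (\<chi> i. complex_of_real ((A *v w) $ i))" for w :: "real ^ 'n"
    by (simp add: vec_eq_iff matrix_vector_mult_def)
  from this[of "(((*v) A) ^^ k) v"] show ?case
    by (simp add: Suc)
qed simp

text \<open>
  Eigenvalues are complex, so the real vector is embedded into the complex space, where its orbit
  under the complexified matrix decays.
\<close>

lemma matrix_power_tendsto_0:
  fixes A :: "real ^ 'n ^ 'n"
  assumes "matrix_spectral_radius A < 1"
  shows "(\<lambda>k. matrix_power A k *v v) \<longlonglongrightarrow> 0"
proof -
  let ?A = "map_matrix complex_of_real A" and ?v = "\<chi> i. complex_of_real (v $ i)"
  have eig: "cmod l < 1" if "w \<noteq> 0" "?A *v w = l *s w" for l w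
  proof -
    have "l \<in> matrix_spectrum A"
      using that unfolding matrix_spectrum_def by blast
    then have "cmod l \<le> matrix_spectral_radius A"
      unfolding matrix_spectral_radius_def by (simp add: finite_matrix_spectrum)
    then show ?thesis
      using assms by simp
  qed
  obtain P where "P \<noteq> 0" "\<And>w. poly_apply ?A P w = 0"
    using annihilating_polynomial by blast
  then have "(\<lambda>k. (((*v) ?A) ^^ k) ?v) \<longlonglongrightarrow> 0"
    using orbit_tendsto_0_if_annihilated eig by blast
  then have "(\<lambda>k. complex_of_real ((matrix_power A k *v v) $ i)) \<longlonglongrightarrow> 0" for i
    unfolding matrix_power_mult_vector map_matrix_power_of_real by (auto dest: tendsto_vec_nth[of _ _ _ i])
  then have "(\<lambda>k. (matrix_power A k *v v) $ i) \<longlonglongrightarrow> 0" for i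
    by (simp add: tendsto_of_real_iff[where 'a = complex and c = 0, simplified])
  then show ?thesis
    by (intro vec_tendstoI) simp
qed

text \<open>
  This bound turns decay of the orbits of the finitely many standard basis vectors into decay of
  the operator norm.
\<close>

lemma matrix_norm_le_sum_columns: "matrix_norm A \<le> (\<Sum>i\<in>UNIV. norm (A *v axis i 1))"
  unfolding matrix_norm_def
proof (rule onorm_bound)
  fix x
  have "A *v x = A *v (\<Sum>i\<in>UNIV. x $ i *\<^sub>R axis i 1)"
    by (simp add: basis_expansion scalar_mult_eq_scaleR[symmetric])
  also have "\<dots> = (\<Sum>i\<in>UNIV. x $ i *\<^sub>R (A *v axis i 1))"
    by (simp add: linear_sum[OF matrix_vector_mul_linear] matrix_vector_mult_scaleR)
  also have "norm \<dots> \<le> (\<Sum>i\<in>UNIV. norm x * norm (A *v axis i 1))"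
    by (intro sum_norm_le) (simp add: component_le_norm_cart mult_right_mono)
  finally show "norm (A *v x) \<le> (\<Sum>i\<in>UNIV. norm (A *v axis i 1)) * norm x"
    by (simp add: sum_distrib_left mult.commute)
qed (simp add: sum_nonneg)

lemma eventually_matrix_norm_power_less_1:
  assumes "matrix_spectral_radius A < 1"
  shows "\<forall>\<^sub>F p in sequentially. matrix_norm (matrix_power A p) < 1"
proof -
  have "(\<lambda>p. \<Sum>i\<in>UNIV. norm (matrix_power A p *v axis i 1)) \<longlonglongrightarrow> (\<Sum>i\<in>(UNIV :: 'a set). 0)"
    by (intro tendsto_sum tendsto_norm_zero matrix_power_tendsto_0 assms)
  then have "\<forall>\<^sub>F p in sequentially. (\<Sum>i\<in>UNIV. norm (matrix_power A p *v axis i 1)) < 1"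
    by (intro order_tendstoD(2)) auto
  then show ?thesis
    by eventually_elim (rule le_less_trans[OF matrix_norm_le_sum_columns])
qed

text \<open>
  A small spectral radius guarantees that the set in the definition of \<^const>\<open>p_tilde\<close> is nonempty,
  so its least element has the defining property.
\<close>

lemma matrix_norm_less_1_if_p_tilde_le:
  assumes "matrix_spectral_radius (jacobian f (at 0)) < 1" and "p_tilde f \<le> p"
  shows "matrix_norm (matrix_power (jacobian f (at 0)) p) < 1"
proof -
  let ?Q = "\<lambda>q. 1 \<le> q \<and> (\<forall>p\<ge>q. matrix_norm (matrix_power (jacobian f (at 0)) p) < 1)"
  obtain K where "\<forall>p\<ge>K. matrix_norm (matrix_power (jacobian f (at 0)) p) < 1"
    using eventually_matrix_norm_power_less_1[OF assms(1)] unfolding eventually_sequentially by blast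
  then have "?Q (max 1 K)"
    by simp
  then have "?Q (p_tilde f)"
    unfolding p_tilde_def by (rule LeastI)
  then show ?thesis
    using assms(2) by blast
qed

section \<open>Differentiability of power series\<close>

lemma summable_on_finite_sum:
  fixes g :: "'i \<Rightarrow> 'b \<Rightarrow> real"
  assumes "\<And>j. j \<in> J \<Longrightarrow> g j summable_on A"
  shows "(\<lambda>x. \<Sum>j\<in>J. g j x) summable_on A"
  using assms by (induction J rule: infinite_finite_induct) (auto intro: summable_on_add)

text \<open>
  The monomials of degree at most \<open>1\<close> form a polynomial \<open>g\<close>, which is differentiable. The others
  sum to at most a constant times \<open>\<parallel>x - a\<parallel>\<^sup>2\<close>: at the point \<open>y\<close> all of whose coordinates differ from
  those of \<open>a\<close> by \<open>t\<close>, the monomial of degree \<open>d\<close> is \<open>t\<^sup>d\<close>, and a monomial of degree \<open>d \<ge> 2\<close> at \<open>x\<close>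
  is at most \<open>\<parallel>x - a\<parallel>\<^sup>d \<le> (\<parallel>x - a\<parallel> / t)\<^sup>2 t\<^sup>d\<close>, so that the absolutely convergent series at \<open>y\<close>
  is a majorant. Hence \<open>f - g\<close> has derivative \<open>0\<close> at \<open>a\<close>.
\<close>

lemma real_analytic_imp_differentiable:
  fixes f :: "real ^ 'n \<Rightarrow> real ^ 'm"
  assumes "f real_analytic_on S" "a \<in> S"
  shows "f differentiable (at a)"
proof -
  define X :: "real ^ 'n \<Rightarrow> ('n \<Rightarrow> nat) \<Rightarrow> real"
    where "X x \<alpha> = (\<Prod>i\<in>UNIV. (x $ i - a $ i) ^ \<alpha> i)" for x \<alpha>
  obtain r c where r: "r > 0" and sum: "\<And>x. x \<in> ball a r \<Longrightarrow> ((\<lambda>\<alpha>. X x \<alpha> *\<^sub>R c \<alpha>) has_sum f x) UNIV"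
    using assms unfolding real_analytic_on_def X_def by meson
  define deg :: "('n \<Rightarrow> nat) \<Rightarrow> nat" where "deg \<alpha> = sum \<alpha> UNIV" for \<alpha>
  define F where "F = {\<alpha>. deg \<alpha> \<le> 1}"
  have "F \<subseteq> (UNIV :: 'n set) \<rightarrow>\<^sub>E {..1}"
  proof
    fix \<alpha> assume "\<alpha> \<in> F"
    then have "\<alpha> i \<le> 1" for i
      using member_le_sum[of i UNIV \<alpha>] by (simp add: F_def deg_def)
    then show "\<alpha> \<in> UNIV \<rightarrow>\<^sub>E {..1}"
      by (simp add: PiE_def)
  qed
  then have F: "finite F"
    by (rule finite_subset) (simp add: finite_PiE)
  \<comment> \<open>Small enough for \<open>y\<close> below to lie in the ball: its distance from \<open>a\<close> is at most \<open>CARD('n) * t = r / 2\<close>.\<close>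
  define t where "t = r / (2 * (real CARD('n)))"
  have t: "t > 0"
    using r by (simp add: t_def)
  define y where "y = a + (\<chi> i. t)"
  have "norm (y - a) \<le> (\<Sum>i\<in>(UNIV::'n set). t)"
    using norm_le_l1_cart[of "y - a"] t by (simp add: y_def)
  also have "\<dots> < r"
    using r by (simp add: t_def)
  finally have y: "y \<in> ball a r"
    by (simp add: dist_norm norm_minus_commute)
  have Xy: "X y \<alpha> = t ^ deg \<alpha>" for \<alpha>
    by (simp add: X_def y_def deg_def power_sum)
  \<comment> \<open>Unconditional summability is absolute for real series, so it is used in each coordinate; \<open>M\<close> is
    the \<open>l1\<close>-norm of the term at \<open>y\<close>.\<close>
  define M where "M \<alpha> = (\<Sum>j\<in>UNIV. \<bar>(t ^ deg \<alpha> *\<^sub>R c \<alpha>) $ j\<bar>)" for \<alpha>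
  have "M summable_on UNIV"
    unfolding M_def
  proof (rule summable_on_finite_sum)
    fix j :: 'm
    have "((\<lambda>\<alpha>. (t ^ deg \<alpha> *\<^sub>R c \<alpha>) $ j) has_sum (f y $ j)) UNIV"
      using has_sum_bounded_linear[OF bounded_linear_vec_nth sum[OF y]] unfolding Xy .
    then show "(\<lambda>\<alpha>. \<bar>(t ^ deg \<alpha> *\<^sub>R c \<alpha>) $ j\<bar>) summable_on UNIV"
      using summable_on_iff_abs_summable_on_real has_sum_imp_summable by (metis (no_types, lifting) real_norm_def summable_on_cong)
  qed
  then have M: "M summable_on (- F)"
    using summable_on_subset_banach by blast
  have M_bound: "t ^ deg \<alpha> * norm (c \<alpha>) \<le> M \<alpha>" for \<alpha>
    using norm_le_l1_cart[of "t ^ deg \<alpha> *\<^sub>R c \<alpha>"] t by (simp add: M_def)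
  define g where "g x = (\<Sum>\<alpha>\<in>F. X x \<alpha> *\<^sub>R c \<alpha>)" for x
  have rem: "norm (f x - g x) \<le> (infsum M (- F) / t\<^sup>2) * (norm (x - a))\<^sup>2"
    if x: "x \<in> ball a (min r t)" for x
  proof -
    define s where "s = norm (x - a)"
    have s: "0 \<le> s" "s < t" "x \<in> ball a r"
      using x by (auto simp: s_def dist_norm norm_minus_commute)
    have 1: "((\<lambda>\<alpha>. X x \<alpha> *\<^sub>R c \<alpha>) has_sum (f x - g x)) (- F)"
      using has_sum_Diff[OF sum[OF s(3)] has_sum_finite[OF F]] by (simp add: g_def Compl_eq_Diff_UNIV)
    have 2: "((\<lambda>\<alpha>. (s / t)\<^sup>2 * M \<alpha>) has_sum ((s / t)\<^sup>2 * infsum M (- F))) (- F)"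
      by (intro has_sum_cmult_right has_sum_infsum M)
    have "norm (X x \<alpha> *\<^sub>R c \<alpha>) \<le> (s / t)\<^sup>2 * M \<alpha>" if \<alpha>: "\<alpha> \<in> - F" for \<alpha>
    proof -
      have "\<bar>X x \<alpha>\<bar> \<le> (\<Prod>i\<in>UNIV. s ^ \<alpha> i)"
        unfolding X_def abs_prod power_abs
        using component_le_norm_cart[of "x - a"] by (intro prod_mono) (auto simp: s_def power_mono)
      also have "\<dots> = s ^ deg \<alpha>"
        by (simp add: deg_def power_sum)
      also have "\<dots> = (s / t) ^ deg \<alpha> * t ^ deg \<alpha>"
        using t by (simp add: power_divide)
      also have "\<dots> \<le> (s / t)\<^sup>2 * t ^ deg \<alpha>"
        using s t \<alpha> by (intro mult_right_mono power_decreasing) (auto simp: F_def)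
      finally have "\<bar>X x \<alpha>\<bar> * norm (c \<alpha>) \<le> (s / t)\<^sup>2 * (t ^ deg \<alpha> * norm (c \<alpha>))"
        unfolding mult.assoc[symmetric] by (intro mult_right_mono) auto
      also have "\<dots> \<le> (s / t)\<^sup>2 * M \<alpha>"
        by (intro mult_left_mono M_bound) auto
      finally show ?thesis
        by simp
    qed
    then have "norm (f x - g x) \<le> (s / t)\<^sup>2 * infsum M (- F)"
      by (rule norm_infsum_le[OF 1 2])
    then show ?thesis
      by (simp add: s_def power_divide mult.commute)
  qed
  define C where "C = infsum M (- F) / t\<^sup>2"
  have fg: "f a = g a"
    using rem[of a] r t by simp
  have C: "C \<ge> 0"
    unfolding C_def M_def by (intro divide_nonneg_nonneg infsum_nonneg sum_nonneg) auto
  have "((\<lambda>x. f x - g x) has_derivative (\<lambda>h. 0)) (at a)"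
    unfolding has_derivative_at_alt
  proof (intro conjI allI impI)
    fix e :: real assume e: "0 < e"
    let ?d = "min (min r t) (e / (C + 1))"
    have "norm (f x - g x - (f a - g a) - 0) \<le> e * norm (x - a)" if "norm (x - a) < ?d" for x
    proof -
      have "norm (f x - g x) \<le> C * norm (x - a) * norm (x - a)"
        using rem[of x] that by (simp add: C_def power2_eq_square dist_norm norm_minus_commute)
      also have "C * norm (x - a) \<le> e"
      proof -
        have "C * norm (x - a) \<le> (C + 1) * norm (x - a)"
          by (simp add: algebra_simps)
        also have "\<dots> \<le> e"
          using that C by (simp add: field_simps)
        finally show ?thesis .
      qed
      finally show ?thesis
        using fg by (simp add: mult_right_mono)
    qed
    moreover have "?d > 0"
      using r t e C by simp
    ultimately show "\<exists>d>0. \<forall>x. norm (x - a) < d \<longrightarrow> norm (f x - g x - (f a - g a) - 0) \<le> e * norm (x - a)"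
      by blast
  qed simp
  then have "(\<lambda>x. f x - g x) differentiable (at a)"
    by (rule differentiableI)
  moreover have "g differentiable (at a)"
  proof -
    have "(\<lambda>x. X x \<alpha>) differentiable (at a)" for \<alpha>
      unfolding X_def differentiable_def
      by (rule exI, rule has_derivative_prod, rule has_derivative_power,
          rule has_derivative_diff[OF bounded_linear.has_derivative[OF bounded_linear_vec_nth has_derivative_ident] has_derivative_const])
    then show ?thesis
      unfolding g_def by (intro differentiable_sum F ballI differentiable_scaleR differentiable_const)
  qed
  ultimately have "(\<lambda>x. (f x - g x) + g x) differentiable (at a)"
    by (rule differentiable_add)
  then show ?thesis
    by simp
qed

section \<open>Existence and positivity of the contraction radius\<close>

lemma iterate_has_derivative:
  fixes f :: "real ^ 'n \<Rightarrow> real ^ 'n"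
  assumes "f differentiable (at 0)" "f 0 = 0"
  shows "((f ^^ p) has_derivative (\<lambda>h. matrix_power (jacobian f (at 0)) p *v h)) (at 0)"
proof (induction p)
  case 0
  then show ?case
    by (simp add: id_def matrix_power_mult_vector)
next
  case (Suc p)
  have "(f ^^ p) 0 = 0"
    using assms(2) by (induction p) auto
  then have "(f has_derivative (\<lambda>h. jacobian f (at 0) *v h)) (at ((f ^^ p) 0))"
    using assms(1) by (simp add: jacobian_works)
  from diff_chain_at[OF Suc this] show ?case
    by (simp add: o_def matrix_power_mult_vector)
qed

text \<open>
  The linearisation error is at most \<open>e * norm x\<close> near \<open>0\<close>, with \<open>e\<close> half of the gap between
  \<open>onorm f'\<close> and \<open>1\<close>, so that \<open>onorm f' + e = 1 - e\<close>.
\<close>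

lemma eventually_norm_less_if_onorm_derivative_less_1:
  fixes f :: "'a::real_normed_vector \<Rightarrow> 'a"
  assumes "(f has_derivative f') (at 0)" "f 0 = 0" "onorm f' < 1"
  shows "\<forall>\<^sub>F x in at 0. norm (f x) < norm x"
proof -
  define e where "e = (1 - onorm f') / 2"
  have lin: "bounded_linear f'" and "e > 0"
    using assms unfolding e_def by (auto intro: has_derivative_bounded_linear)
  then obtain d where d: "d > 0" "\<And>x. norm x < d \<Longrightarrow> norm (f x - f' x) \<le> e * norm x"
    using assms(1,2) unfolding has_derivative_at_alt by (metis diff_zero)
  have "norm (f x) < norm x" if x: "x \<noteq> 0" "norm x < d" for x
  proof -
    have "norm (f x) \<le> norm (f' x) + norm (f x - f' x)"
      by (rule norm_triangle_sub)
    also have "\<dots> \<le> onorm f' * norm x + e * norm x"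
      using onorm[OF lin] d(2)[OF x(2)] by (rule add_mono)
    also have "\<dots> = (1 - e) * norm x"
      by (simp add: e_def field_simps)
    also have "\<dots> < norm x"
      using \<open>e > 0\<close> x by simp
    finally show ?thesis .
  qed
  then show ?thesis
    using d(1) unfolding eventually_at by (auto simp: dist_norm)
qed

lemma contraction_radius_exists:
  fixes f :: "real ^ 'n \<Rightarrow> real ^ 'n"
  assumes "open \<Omega>" "0 \<in> \<Omega>" "f differentiable (at 0)" "f 0 = 0"
    and "matrix_spectral_radius (jacobian f (at 0)) < 1"
  shows "\<exists>r. contraction_radius f \<Omega> r"
proof -
  have "\<forall>\<^sub>F x in at 0. norm ((f ^^ p) x) < norm x" if "p \<ge> p_tilde f" for p
  proof (rule eventually_norm_less_if_onorm_derivative_less_1)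
    show "((f ^^ p) has_derivative (\<lambda>h. matrix_power (jacobian f (at 0)) p *v h)) (at 0)"
      by (rule iterate_has_derivative) fact+
    show "(f ^^ p) 0 = 0"
      using assms(4) by (induction p) auto
    show "onorm (\<lambda>h. matrix_power (jacobian f (at 0)) p *v h) < 1"
      using matrix_norm_less_1_if_p_tilde_le[OF assms(5) that] by (simp add: matrix_norm_def)
  qed
  then have "\<forall>\<^sub>F x in at 0. \<forall>p\<in>{p_tilde f..2 * p_tilde f - 1}. norm ((f ^^ p) x) < norm x"
    by (intro eventually_ball_finite) auto
  then obtain d where d: "d > 0"
    "\<And>x p. x \<noteq> 0 \<Longrightarrow> norm x < d \<Longrightarrow> p \<in> {p_tilde f..2 * p_tilde f - 1} \<Longrightarrow> norm ((f ^^ p) x) < norm x"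
    unfolding eventually_at by (auto simp: dist_norm)
  obtain e where e: "e > 0" "ball 0 e \<subseteq> \<Omega>"
    using assms(1,2) open_contains_ball by blast
  have "contraction_radius f \<Omega> (min d e)"
    unfolding contraction_radius_def using d e by (auto simp: subset_iff)
  then show ?thesis ..
qed

text \<open>
  A ball around \<open>0\<close> is the union of the smaller ones, so the supremum of the admissible radii is
  admissible; it is finite because a single inadmissible positive radius bounds all admissible ones.
  This is also what gives the \<open>GREATEST\<close> in \<^const>\<open>R_tilde\<close> a meaning.
\<close>

lemma contraction_radius_Greatest:
  assumes "contraction_radius f \<Omega> r0" and "\<not> (\<forall>r>0. contraction_radius f \<Omega> r)"
  shows "contraction_radius f \<Omega> (GREATEST r. contraction_radius f \<Omega> r)"
proof -
  let ?S = "{r. contraction_radius f \<Omega> r}"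
  obtain b where b: "b > 0" "\<not> contraction_radius f \<Omega> b"
    using assms(2) by blast
  have mono: "contraction_radius f \<Omega> r'" if "contraction_radius f \<Omega> r" "0 < r'" "r' \<le> r" for r r'
    using that unfolding contraction_radius_def by (auto simp: subset_iff)
  have le: "r \<le> b" if "contraction_radius f \<Omega> r" for r
    using mono[OF that b(1)] b(2) by linarith
  then have bdd: "bdd_above ?S"
    by (intro bdd_aboveI) auto
  have "r0 \<le> Sup ?S"
    by (rule cSup_upper[OF _ bdd]) (simp add: assms(1))
  moreover have "0 < r0"
    using assms(1) by (simp add: contraction_radius_def)
  ultimately have pos: "0 < Sup ?S"
    by linarith
  have "\<exists>r. contraction_radius f \<Omega> r \<and> x \<in> ball 0 r" if "x \<in> ball 0 (Sup ?S)" for x :: "real ^ 'a"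
    using less_cSup_iff[OF _ bdd, of "norm x"] assms(1) that by auto
  then have "contraction_radius f \<Omega> (Sup ?S)"
    using pos unfolding contraction_radius_def by blast
  moreover have "r \<le> Sup ?S" if "contraction_radius f \<Omega> r" for r
    by (rule cSup_upper[OF _ bdd]) (simp add: that)
  ultimately show ?thesis
    by (rule GreatestI2_order)
qed

section \<open>Averages along the orbit\<close>

text \<open>
  Terms beyond \<open>K\<close> are below \<open>e / 2\<close>, and the earlier ones contribute at most a constant \<open>C\<close>, which
  is dominated by \<open>(p + 1) * (e / 2)\<close> once \<open>p\<close> is large.
\<close>

lemma sum_less_if_tendsto_0:
  fixes a :: "nat \<Rightarrow> real"
  assumes "a \<longlonglongrightarrow> 0" "0 < e"
  shows "\<exists>p\<ge>n. (\<Sum>k=0..p. a k) < (real p + 1) * e"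
proof -
  obtain K where K: "\<And>k. k \<ge> K \<Longrightarrow> a k < e / 2"
    using order_tendstoD(2)[OF assms(1), of "e / 2"] assms(2) unfolding eventually_sequentially by auto
  define C where "C = (\<Sum>k<K. \<bar>a k\<bar>)"
  obtain m where m: "2 * C / e < real m"
    using reals_Archimedean2 by blast
  define p where "p = max n (max m K)"
  have "{0..p} = {..<K} \<union> {K..p}"
    by (auto simp: p_def)
  then have "(\<Sum>k=0..p. a k) = (\<Sum>k<K. a k) + (\<Sum>k=K..p. a k)"
    by (simp add: sum.union_disjoint ivl_disj_int)
  also have "(\<Sum>k<K. a k) \<le> C"
    unfolding C_def by (intro sum_mono) auto
  also have "(\<Sum>k=K..p. a k) \<le> (\<Sum>k=K..p. e / 2)"
    using K by (intro sum_mono) (auto simp: less_imp_le)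
  also have "\<dots> \<le> (\<Sum>k=0..p. e / 2)"
    using assms(2) by (intro sum_mono2) auto
  also have "\<dots> = (real p + 1) * (e / 2)"
    by simp
  finally have "(\<Sum>k=0..p. a k) \<le> C + (real p + 1) * (e / 2)"
    by simp
  moreover have "C < (real p + 1) * (e / 2)"
  proof -
    have "2 * C / e < real p + 1"
      using m by (simp add: p_def)
    then show ?thesis
      using assms(2) by (simp add: field_simps)
  qed
  ultimately have "(\<Sum>k=0..p. a k) < (real p + 1) * e"
    by (simp add: field_simps)
  then show ?thesis
    by (intro exI[of _ p]) (simp add: p_def)
qed

theorem theorem3p9:
  fixes f :: "real ^ 'n \<Rightarrow> real ^ 'n" and \<Omega> :: "(real ^ 'n) set"
  assumes "open \<Omega>" and "connected \<Omega>" and "0 \<in> \<Omega>"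
    and "f ` \<Omega> \<subseteq> \<Omega>"
    and "f real_analytic_on \<Omega>"
    and "f 0 = 0"
    and "matrix_spectral_radius (jacobian f (at 0)) < 1"
  shows "\<forall>x \<in> attraction_domain f \<Omega>. \<exists>p. p \<ge> p_tilde f \<and> x \<in> N_tilde f \<Omega> p"
proof
  fix x
  assume "x \<in> attraction_domain f \<Omega>"
  then have x: "x \<in> \<Omega>" "(\<lambda>k. (f ^^ k) x) \<longlonglongrightarrow> 0"
    by (auto simp: attraction_domain_def)
  show "\<exists>p. p \<ge> p_tilde f \<and> x \<in> N_tilde f \<Omega> p"
  proof (cases "\<forall>r>0. contraction_radius f \<Omega> r")
    case True
    then have "R_tilde f \<Omega> = \<infinity>"
      by (simp add: R_tilde_def)
    then show ?thesis
      using x(1) by (auto simp: N_tilde_def)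
  next
    case False
    define R where "R = (GREATEST r. contraction_radius f \<Omega> r)"
    have R_tilde: "R_tilde f \<Omega> = ereal R"
      unfolding R_tilde_def R_def using False by (rule if_not_P)
    obtain r where "contraction_radius f \<Omega> r"
      using contraction_radius_exists real_analytic_imp_differentiable assms by blast
    then have "contraction_radius f \<Omega> R"
      unfolding R_def using False by (rule contraction_radius_Greatest)
    then have "0 < R\<^sup>2"
      by (simp add: contraction_radius_def)
    moreover have "(\<lambda>k. (norm ((f ^^ k) x))\<^sup>2) \<longlonglongrightarrow> 0"
      using tendsto_power[OF tendsto_norm_zero[OF x(2)], of 2] by simp
    ultimately obtain p where "p \<ge> p_tilde f"
      "(\<Sum>k=0..p. (norm ((f ^^ k) x))\<^sup>2) < (real p + 1) * R\<^sup>2"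
      using sum_less_if_tendsto_0 by blast
    then show ?thesis
      using x(1) by (auto simp: N_tilde_def R_tilde V_sum_def)
  qed
qed

end
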